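(* Let $\pi$ be a groupoid, $V$ a $\pi$-graded vector space of finite type over $\mathbb{C}$, $\bar\kappa:\mathrm{Ob}(\pi)\to\mathbb{C}\setminus\{0\}$ a map, and $T(a)$, $a\in\mathrm{Ob}(\pi)$, a local dynamical Temperley--Lieb operator on $V$ associated to $\bar\kappa$. Let $f$ be a complex-valued function and suppose that $x=f(z)$, $x'=f(z')$, $x''=f(z'')$, with $z''=z'-z$, satisfy, for every object $a$ and every arrow $\alpha$ with $s(\alpha)=a$, $$x''=\frac{x'-x}{1+\bar\kappa(t(\alpha))\,x+xx'},\qquad x''=\frac{x'-x}{1+\bar\kappa(a)\,x+xx'}$$ (the denominators being nonzero). Then the operators $\check R(x,a)=\mathrm{id}+x\,T(a)$ satisfy the dynamical Yang--Baxter equation: for every $a\in\mathrm{Ob}(\pi)$, $$\check R^{(23)}(x,ah^{(1)})\,\check R^{(12)}(x',a)\,\check R^{(23)}(x'',ah^{(1)})=\check R^{(12)}(x'',a)\,\check R^{(23)}(x',ah^{(1)})\,\check R^{(12)}(x,a).$$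
   Context: A groupoid $\pi$ is a small category in which every morphism (arrow) is invertible; $s,t:\pi\to\mathrm{Ob}(\pi)$ are source and target, and $\beta\circ\alpha$ is defined when $t(\alpha)=s(\beta)$. A $\pi$-graded vector space of finite type over $\mathbb{C}$ is a collection $V=(V_\alpha)_{\alpha\in\pi}$ of finite dimensional vector spaces indexed by the arrows such that for each object $a$ there are only finitely many arrows $\alpha$ with source or target $a$ and $V_\alpha\neq0$. Tensor products are defined by $(V\otimes W)_\gamma=\bigoplus_{\beta\circ\alpha=\gamma}V_\alpha\otimes W_\beta$. For a family $X(a)\in\bigoplus_{\alpha\in s^{-1}(a)}\mathrm{End}_{\mathbb{C}}((V\otimes V)_\alpha)$, $a\in\mathrm{Ob}(\pi)$, and for $u\otimes v\otimes w\in V_{\alpha_1}\otimes V_{\alpha_2}\otimes V_{\alpha_3}$ with $\alpha_1,\alpha_2,\alpha_3$ composable and $s(\alpha_1)=a$, set $X^{(12)}(a)(u\otimes v\otimes w)=X(a)(u\otimes v)\otimes w$ and $X^{(23)}(ah^{(1)})(u\otimes v\otimes w)=u\otimes X(t(\alpha_1))(v\otimes w)$. A local dynamical Temperley--Lieb operator on $V$ associated to $\bar\kappa$ is a family $T(a)\in\bigoplus_{\alpha\in s^{-1}(a)}\mathrm{End}_{\mathbb{C}}((V\otimes V)_\alpha)$, $a\in\mathrm{Ob}(\pi)$, such that for all $a$: $T(a)T(a)=\bar\kappa(a)T(a)$; $T^{(12)}(a)T^{(23)}(ah^{(1)})T^{(12)}(a)=T^{(12)}(a)$; $T^{(23)}(ah^{(1)})T^{(12)}(a)T^{(23)}(ah^{(1)})=T^{(23)}(ah^{(1)})$.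 *)

theory Defs
  imports Complex_Main "HOL-Library.Poly_Mapping"
begin

section \<open>Complex vector spaces\<close>

class scaleC =
  fixes scaleC :: "complex \<Rightarrow> 'a \<Rightarrow> 'a"  (infixr "*\<^sub>C" 75)

class complex_vector = scaleC + ab_group_add +
  assumes scaleC_add_right: "c *\<^sub>C (x + y) = c *\<^sub>C x + c *\<^sub>C y"
    and scaleC_add_left: "(c + d) *\<^sub>C x = c *\<^sub>C x + d *\<^sub>C x"
    and scaleC_scaleC: "c *\<^sub>C (d *\<^sub>C x) = (c * d) *\<^sub>C x"
    and scaleC_one: "1 *\<^sub>C x = x"

global_interpretation cvec: vector_space "scaleC :: complex \<Rightarrow> 'a \<Rightarrow> 'a :: complex_vector"
  by unfold_locales (simp_all add: scaleC_add_right scaleC_add_left scaleC_scaleC scaleC_one)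

global_interpretation cvec_pair: vector_space_pair
  "scaleC :: complex \<Rightarrow> 'a \<Rightarrow> 'a :: complex_vector"
  "scaleC :: complex \<Rightarrow> 'b \<Rightarrow> 'b :: complex_vector"
  by unfold_locales

abbreviation clinear :: "('a::complex_vector \<Rightarrow> 'b::complex_vector) \<Rightarrow> bool" where
  "clinear \<equiv> Vector_Spaces.linear scaleC scaleC"

lemma clinearI:
  assumes "\<And>x y. f (x + y) = f x + f y" and "\<And>c x. f (c *\<^sub>C x) = c *\<^sub>C f x"
  shows "clinear f"
  using assms by (simp add: Vector_Spaces.linear_def module_hom_def module_hom_axioms_def
      cvec.vector_space_axioms cvec.module_axioms)

definition clinear_on :: "'a::complex_vector set \<Rightarrow> ('a \<Rightarrow> 'b::complex_vector) \<Rightarrow> bool" where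
  "clinear_on S f \<longleftrightarrow>
     (\<forall>x\<in>S. \<forall>y\<in>S. f (x + y) = f x + f y) \<and> (\<forall>c. \<forall>x\<in>S. f (c *\<^sub>C x) = c *\<^sub>C f x)"

definition cbilinear ::
  "('a::complex_vector \<Rightarrow> 'b::complex_vector \<Rightarrow> 'c::complex_vector) \<Rightarrow> bool" where
  "cbilinear f \<longleftrightarrow> (\<forall>y. clinear (\<lambda>x. f x y)) \<and> (\<forall>x. clinear (f x))"

instantiation complex :: complex_vector
begin

definition scaleC_complex :: "complex \<Rightarrow> complex \<Rightarrow> complex" where
  "scaleC_complex c x = c * x"

instance
  by standard (simp_all add: scaleC_complex_def algebra_simps)

end

instantiation poly_mapping :: (type, complex_vector) complex_vector
begin

lift_definition scaleC_poly_mapping :: "complex \<Rightarrow> ('a \<Rightarrow>\<^sub>0 'b) \<Rightarrow> ('a \<Rightarrow>\<^sub>0 'b)"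
  is "\<lambda>c p k. c *\<^sub>C p k"
  by (erule rev_finite_subset) auto

instance
  by standard
    (transfer; simp add: fun_eq_iff scaleC_add_right scaleC_add_left scaleC_scaleC scaleC_one)+

end

lemma lookup_scaleC [simp]: "Poly_Mapping.lookup (c *\<^sub>C p) k = c *\<^sub>C Poly_Mapping.lookup p k"
  by transfer simp

lemma single_scaleC: "Poly_Mapping.single k (c *\<^sub>C x) = c *\<^sub>C Poly_Mapping.single k x"
  by (rule poly_mapping_eqI) (simp add: lookup_single when_def)


section \<open>Tensor products\<close>

text \<open>The tensor product is the free vector space on \<^typ>\<open>'a \<times> 'b\<close> modulo the bilinearity relations.\<close>

definition tensor_relators ::
  "(('a::complex_vector \<times> 'b::complex_vector) \<Rightarrow>\<^sub>0 complex) set" where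
  "tensor_relators =
     {Poly_Mapping.single (u + u', v) 1 - Poly_Mapping.single (u, v) 1
        - Poly_Mapping.single (u', v) 1 | u u' v. True}
   \<union> {Poly_Mapping.single (u, v + v') 1 - Poly_Mapping.single (u, v) 1
        - Poly_Mapping.single (u, v') 1 | u v v'. True}
   \<union> {Poly_Mapping.single (c *\<^sub>C u, v) 1 - c *\<^sub>C Poly_Mapping.single (u, v) 1 | c u v. True}
   \<union> {Poly_Mapping.single (u, c *\<^sub>C v) 1 - c *\<^sub>C Poly_Mapping.single (u, v) 1 | c u v. True}"

definition tensor_eq ::
  "(('a::complex_vector \<times> 'b::complex_vector) \<Rightarrow>\<^sub>0 complex) \<Rightarrow> (('a \<times> 'b) \<Rightarrow>\<^sub>0 complex) \<Rightarrow> bool"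
  where "tensor_eq p q \<longleftrightarrow> p - q \<in> cvec.span tensor_relators"

lemma tensor_eq_equivp:
  "equivp (tensor_eq :: (('a::complex_vector \<times> 'b::complex_vector) \<Rightarrow>\<^sub>0 complex) \<Rightarrow> _)"
  (is "equivp ?R")
proof (rule equivpI)
  show "reflp ?R"
    by (auto simp: reflp_def tensor_eq_def cvec.span_zero)
  show "symp ?R"
  proof (rule sympI)
    fix p q :: "('a \<times> 'b) \<Rightarrow>\<^sub>0 complex" assume "tensor_eq p q"
    then have "- (p - q) \<in> cvec.span tensor_relators"
      unfolding tensor_eq_def by (rule cvec.span_neg)
    then show "tensor_eq q p" by (simp add: tensor_eq_def)
  qed
  show "transp ?R"
  proof (rule transpI)
    fix p q r :: "('a \<times> 'b) \<Rightarrow>\<^sub>0 complex" assume "tensor_eq p q" "tensor_eq q r"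
    then have "(p - q) + (q - r) \<in> cvec.span tensor_relators"
      unfolding tensor_eq_def by (rule cvec.span_add)
    then show "tensor_eq p r" by (simp add: tensor_eq_def)
  qed
qed

quotient_type (overloaded) ('a, 'b) tensor =
  "('a::complex_vector \<times> 'b::complex_vector) \<Rightarrow>\<^sub>0 complex" / tensor_eq
  by (rule tensor_eq_equivp)

instantiation tensor :: (complex_vector, complex_vector) complex_vector
begin

lift_definition zero_tensor :: "('a, 'b) tensor" is 0 .

lift_definition plus_tensor :: "('a, 'b) tensor \<Rightarrow> ('a, 'b) tensor \<Rightarrow> ('a, 'b) tensor" is "(+)"
  unfolding tensor_eq_def by (metis add_diff_add cvec.span_add)

lift_definition uminus_tensor :: "('a, 'b) tensor \<Rightarrow> ('a, 'b) tensor" is uminus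
  unfolding tensor_eq_def by (metis cvec.span_neg minus_diff_minus)

lift_definition minus_tensor :: "('a, 'b) tensor \<Rightarrow> ('a, 'b) tensor \<Rightarrow> ('a, 'b) tensor" is "(-)"
proof -
  fix p p' q q' :: "('a \<times> 'b) \<Rightarrow>\<^sub>0 complex"
  assume "tensor_eq p p'" "tensor_eq q q'"
  then have "(p - p') - (q - q') \<in> cvec.span tensor_relators"
    unfolding tensor_eq_def by (rule cvec.span_diff)
  then show "tensor_eq (p - q) (p' - q')"
    by (simp add: tensor_eq_def algebra_simps)
qed

lift_definition scaleC_tensor :: "complex \<Rightarrow> ('a, 'b) tensor \<Rightarrow> ('a, 'b) tensor" is scaleC
  unfolding tensor_eq_def
  by (metis cvec.scale_right_diff_distrib cvec.span_scale)

instance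
proof
  fix a b c :: "('a, 'b) tensor" and r s :: complex
  show "a + b + c = a + (b + c)"
    by transfer (simp add: tensor_eq_def cvec.span_zero add.assoc)
  show "a + b = b + a"
    by transfer (simp add: tensor_eq_def cvec.span_zero add.commute)
  show "0 + a = a"
    by transfer (simp add: tensor_eq_def cvec.span_zero)
  show "- a + a = 0"
    by transfer (simp add: tensor_eq_def cvec.span_zero)
  show "a - b = a + - b"
    by transfer (simp add: tensor_eq_def cvec.span_zero)
  show "r *\<^sub>C (a + b) = r *\<^sub>C a + r *\<^sub>C b"
    by transfer (simp add: tensor_eq_def cvec.span_zero scaleC_add_right)
  show "(r + s) *\<^sub>C a = r *\<^sub>C a + s *\<^sub>C a"
    by transfer (simp add: tensor_eq_def cvec.span_zero scaleC_add_left)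
  show "r *\<^sub>C (s *\<^sub>C a) = (r * s) *\<^sub>C a"
    by transfer (simp add: tensor_eq_def cvec.span_zero scaleC_scaleC)
  show "1 *\<^sub>C a = a"
    by transfer (simp add: tensor_eq_def cvec.span_zero scaleC_one)
qed

end

lift_definition tensor_of :: "'a::complex_vector \<Rightarrow> 'b::complex_vector \<Rightarrow> ('a, 'b) tensor"
  (infixr "\<otimes>" 72) is "\<lambda>u v. Poly_Mapping.single (u, v) 1" .

lemma tensor_add_left: "(u + u') \<otimes> v = u \<otimes> v + u' \<otimes> v"
  apply transfer
  apply (unfold tensor_eq_def)
  apply (rule cvec.span_base)
  apply (unfold tensor_relators_def diff_diff_eq [symmetric])
  apply blast
  done

lemma tensor_add_right: "u \<otimes> (v + v') = u \<otimes> v + u \<otimes> v'"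
  apply transfer
  apply (unfold tensor_eq_def)
  apply (rule cvec.span_base)
  apply (unfold tensor_relators_def diff_diff_eq [symmetric])
  apply blast
  done

lemma tensor_scaleC_left: "(c *\<^sub>C u) \<otimes> v = c *\<^sub>C (u \<otimes> v)"
  apply transfer
  apply (unfold tensor_eq_def)
  apply (rule cvec.span_base)
  apply (unfold tensor_relators_def)
  apply blast
  done

lemma tensor_scaleC_right: "u \<otimes> (c *\<^sub>C v) = c *\<^sub>C (u \<otimes> v)"
  apply transfer
  apply (unfold tensor_eq_def)
  apply (rule cvec.span_base)
  apply (unfold tensor_relators_def)
  apply blast
  done

lemma cbilinear_tensor_of: "cbilinear (\<otimes>)"
  unfolding cbilinear_def
  by (auto intro!: clinearI simp: tensor_add_left tensor_add_right
      tensor_scaleC_left tensor_scaleC_right)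

definition free_ev ::
  "('a \<Rightarrow> 'b \<Rightarrow> 'c::complex_vector) \<Rightarrow> (('a \<times> 'b) \<Rightarrow>\<^sub>0 complex) \<Rightarrow> 'c" where
  "free_ev f p =
     (\<Sum>k\<in>Poly_Mapping.keys p. Poly_Mapping.lookup p k *\<^sub>C f (fst k) (snd k))"

lemma free_ev_superset:
  assumes "finite S" "Poly_Mapping.keys p \<subseteq> S"
  shows "free_ev f p = (\<Sum>k\<in>S. Poly_Mapping.lookup p k *\<^sub>C f (fst k) (snd k))"
  unfolding free_ev_def
  by (rule sum.mono_neutral_left) (use assms in \<open>auto simp: in_keys_iff\<close>)

lemma clinear_free_ev: "clinear (free_ev f)"
proof (rule clinearI)
  fix p q :: "('a \<times> 'b) \<Rightarrow>\<^sub>0 complex" and c :: complex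
  let ?S = "Poly_Mapping.keys p \<union> Poly_Mapping.keys q"
  have "free_ev f (p + q) = (\<Sum>k\<in>?S. Poly_Mapping.lookup (p + q) k *\<^sub>C f (fst k) (snd k))"
    by (rule free_ev_superset) (simp_all add: Poly_Mapping.keys_add)
  also have "\<dots> = free_ev f p + free_ev f q"
    by (simp add: free_ev_superset[of ?S p] free_ev_superset[of ?S q] lookup_add
        scaleC_add_left sum.distrib)
  finally show "free_ev f (p + q) = free_ev f p + free_ev f q" .
  have "free_ev f (c *\<^sub>C p)
      = (\<Sum>k\<in>Poly_Mapping.keys p. Poly_Mapping.lookup (c *\<^sub>C p) k *\<^sub>C f (fst k) (snd k))"
    by (rule free_ev_superset) (auto simp: in_keys_iff)
  also have "\<dots> = c *\<^sub>C free_ev f p"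
    by (simp add: free_ev_def cvec.scale_sum_right scaleC_complex_def)
  finally show "free_ev f (c *\<^sub>C p) = c *\<^sub>C free_ev f p" .
qed

lemma free_ev_single [simp]: "free_ev f (Poly_Mapping.single (u, v) 1) = f u v"
  by (simp add: free_ev_def)

lemma free_ev_respects:
  assumes "cbilinear f" "tensor_eq p q"
  shows "free_ev f p = free_ev f q"
proof -
  have *: "free_ev f r = 0" if "r \<in> tensor_relators" for r
  proof -
    have l: "clinear (\<lambda>x. f x y)" "clinear (f x)" for x y
      using assms(1) by (auto simp: cbilinear_def)
    note [simp] = cvec_pair.linear_diff[OF clinear_free_ev]
      cvec_pair.linear_scale[OF clinear_free_ev]
      cvec_pair.linear_add[OF l(1)] cvec_pair.linear_add[OF l(2)]
      cvec_pair.linear_scale[OF l(1)] cvec_pair.linear_scale[OF l(2)]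
    from that show ?thesis
      by (auto simp: tensor_relators_def)
  qed
  have "free_ev f (p - q) = 0"
    using assms(2) unfolding tensor_eq_def
    by (rule cvec_pair.linear_eq_0_on_span[OF clinear_free_ev *, rotated])
  then show ?thesis
    by (simp add: cvec_pair.linear_diff[OF clinear_free_ev])
qed

lemma span_tensors:
  "cvec.span {u \<otimes> v | (u::'a::complex_vector) (v::'b::complex_vector). True} = UNIV"
proof -
  have "t \<in> cvec.span {u \<otimes> v | (u::'a) (v::'b). True}" for t :: "('a, 'b) tensor"
  proof (induction t rule: tensor.abs_induct)
    fix p :: "('a \<times> 'b) \<Rightarrow>\<^sub>0 complex"
    show "abs_tensor p \<in> cvec.span {u \<otimes> v | u v. True}"
    proof (induction p rule: update_induct)
      case const
      then show ?case
        by (metis cvec.span_zero zero_tensor.abs_eq)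
    next
      case (update p k c)
      have eq: "Poly_Mapping.update k c p = p + c *\<^sub>C Poly_Mapping.single k 1"
        using update(1)
        by (intro poly_mapping_eqI)
          (auto simp: lookup_update lookup_add lookup_single when_def in_keys_iff
            scaleC_complex_def)
      have "abs_tensor (Poly_Mapping.update k c p) = abs_tensor p + c *\<^sub>C (fst k \<otimes> snd k)"
        by (simp add: eq plus_tensor.abs_eq scaleC_tensor.abs_eq tensor_of.abs_eq)
      then show ?case
        using update(3) by (metis (mono_tags, lifting) cvec.span_add cvec.span_base cvec.span_scale
            mem_Collect_eq)
    qed
  qed
  then show ?thesis by blast
qed

lemma clinear_tensor_ext:
  fixes F F' :: "('a::complex_vector, 'b::complex_vector) tensor \<Rightarrow> 'c::complex_vector"
  assumes "clinear F" "clinear F'" and "\<And>u v. F (u \<otimes> v) = F' (u \<otimes> v)"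
  shows "F = F'"
proof
  fix t :: "('a, 'b) tensor"
  have "t \<in> cvec.span {u \<otimes> v | u v. True}" by (subst span_tensors) simp
  then show "F t = F' t"
    by (rule cvec_pair.linear_eq_on[OF assms(1,2)]) (use assms(3) in auto)
qed

definition tensor_lift ::
  "('a::complex_vector \<Rightarrow> 'b::complex_vector \<Rightarrow> 'c::complex_vector) \<Rightarrow> ('a, 'b) tensor \<Rightarrow> 'c" where
  "tensor_lift f = (THE F. clinear F \<and> (\<forall>u v. F (u \<otimes> v) = f u v))"

lemma tensor_lift_exists:
  assumes "cbilinear f"
  shows "\<exists>!F. clinear F \<and> (\<forall>u v. F (u \<otimes> v) = f u v)"
proof -
  define F where "F t = free_ev f (rep_tensor t)" for t
  have F: "F (abs_tensor p) = free_ev f p" for p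
    unfolding F_def using free_ev_respects[OF assms]
    by (meson Quotient3_rep_abs Quotient3_tensor tensor_eq_equivp equivp_reflp)
  have "F (s + t) = F s + F t" for s t
    by (induction s rule: tensor.abs_induct, induction t rule: tensor.abs_induct)
      (simp add: plus_tensor.abs_eq F cvec_pair.linear_add[OF clinear_free_ev])
  moreover have "F (c *\<^sub>C t) = c *\<^sub>C F t" for c t
    by (induction t rule: tensor.abs_induct)
      (simp add: scaleC_tensor.abs_eq F cvec_pair.linear_scale[OF clinear_free_ev])
  ultimately have "clinear F" by (rule clinearI)
  moreover have "F (u \<otimes> v) = f u v" for u v
    by (simp add: tensor_of.abs_eq F)
  ultimately have *: "clinear F \<and> (\<forall>u v. F (u \<otimes> v) = f u v)" by blast
  show ?thesis
  proof (intro ex1I[of _ F])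
    show "clinear F \<and> (\<forall>u v. F (u \<otimes> v) = f u v)" by (rule *)
  next
    fix F' assume "clinear F' \<and> (\<forall>u v. F' (u \<otimes> v) = f u v)"
    with * show "F' = F" by (intro clinear_tensor_ext) auto
  qed
qed

lemma
  assumes "cbilinear f"
  shows clinear_tensor_lift: "clinear (tensor_lift f)"
    and tensor_lift_tensor: "tensor_lift f (u \<otimes> v) = f u v"
  using theI'[OF tensor_lift_exists[OF assms]] by (auto simp: tensor_lift_def)

definition tensor_assoc ::
  "(('a::complex_vector, 'b::complex_vector) tensor, 'c::complex_vector) tensor
     \<Rightarrow> ('a, ('b, 'c) tensor) tensor" where
  "tensor_assoc = tensor_lift (\<lambda>p w. tensor_lift (\<lambda>u v. u \<otimes> (v \<otimes> w)) p)"

lemma cbilinear_tensor_lift: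
  assumes "\<And>w. cbilinear (f w)" and "\<And>u v. clinear (\<lambda>w. f w u v)"
  shows "cbilinear (\<lambda>p w. tensor_lift (f w) p)"
proof -
  have "clinear (\<lambda>w. tensor_lift (f w) p)" for p
  proof (rule clinearI)
    fix w w' and c :: complex
    note lin = clinear_tensor_lift[OF assms(1)]
    have "tensor_lift (f (w + w')) = (\<lambda>p. tensor_lift (f w) p + tensor_lift (f w') p)"
      by (rule clinear_tensor_ext)
        (auto intro!: lin cvec_pair.linear_compose_add
          simp: tensor_lift_tensor[OF assms(1)] cvec_pair.linear_add[OF assms(2)])
    then show "tensor_lift (f (w + w')) p = tensor_lift (f w) p + tensor_lift (f w') p"
      by metis
    have "tensor_lift (f (c *\<^sub>C w)) = (\<lambda>p. c *\<^sub>C tensor_lift (f w) p)"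
      by (rule clinear_tensor_ext)
        (auto intro!: lin cvec_pair.linear_compose_scale_right
          simp: tensor_lift_tensor[OF assms(1)] cvec_pair.linear_scale[OF assms(2)])
    then show "tensor_lift (f (c *\<^sub>C w)) p = c *\<^sub>C tensor_lift (f w) p"
      by metis
  qed
  then show ?thesis
    using clinear_tensor_lift[OF assms(1)] by (auto simp: cbilinear_def)
qed

lemma cbilinear_assoc_aux: "cbilinear (\<lambda>p w. tensor_lift (\<lambda>u v. u \<otimes> (v \<otimes> w)) p)"
  by (rule cbilinear_tensor_lift)
    (auto simp: cbilinear_def tensor_add_left tensor_add_right tensor_scaleC_left
      tensor_scaleC_right intro!: clinearI)

lemma clinear_tensor_assoc: "clinear tensor_assoc"
  unfolding tensor_assoc_def by (rule clinear_tensor_lift[OF cbilinear_assoc_aux])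

lemma tensor_assoc_tensor: "tensor_assoc ((u \<otimes> v) \<otimes> w) = u \<otimes> (v \<otimes> w)"
proof -
  have *: "cbilinear (\<lambda>u v. u \<otimes> (v \<otimes> w))"
    by (auto simp: cbilinear_def tensor_add_left tensor_add_right tensor_scaleC_left
      tensor_scaleC_right intro!: clinearI)
  show ?thesis
    unfolding tensor_assoc_def
    by (simp add: tensor_lift_tensor[OF cbilinear_assoc_aux] tensor_lift_tensor[OF *])
qed


section \<open>Groupoids and graded vector spaces\<close>

record ('o, 'g) category_data =
  obj :: "'o set"
  arr :: "'g set"
  src :: "'g \<Rightarrow> 'o"
  tgt :: "'g \<Rightarrow> 'o"
  idt :: "'o \<Rightarrow> 'g"
  cmp :: "'g \<Rightarrow> 'g \<Rightarrow> 'g"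

text \<open>\<^term>\<open>cmp G \<beta> \<alpha>\<close> is \<open>\<beta> \<circ> \<alpha>\<close>, meaningful when \<^prop>\<open>tgt G \<alpha> = src G \<beta>\<close>.\<close>

locale groupoid =
  fixes G :: "('o, 'g) category_data"
  assumes src_obj: "\<alpha> \<in> arr G \<Longrightarrow> src G \<alpha> \<in> obj G"
    and tgt_obj: "\<alpha> \<in> arr G \<Longrightarrow> tgt G \<alpha> \<in> obj G"
    and idt_arr: "a \<in> obj G \<Longrightarrow> idt G a \<in> arr G"
    and src_idt: "a \<in> obj G \<Longrightarrow> src G (idt G a) = a"
    and tgt_idt: "a \<in> obj G \<Longrightarrow> tgt G (idt G a) = a"
    and cmp_arr: "\<alpha> \<in> arr G \<Longrightarrow> \<beta> \<in> arr G \<Longrightarrow> tgt G \<alpha> = src G \<beta> \<Longrightarrow> cmp G \<beta> \<alpha> \<in> arr G"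
    and src_cmp: "\<alpha> \<in> arr G \<Longrightarrow> \<beta> \<in> arr G \<Longrightarrow> tgt G \<alpha> = src G \<beta> \<Longrightarrow>
        src G (cmp G \<beta> \<alpha>) = src G \<alpha>"
    and tgt_cmp: "\<alpha> \<in> arr G \<Longrightarrow> \<beta> \<in> arr G \<Longrightarrow> tgt G \<alpha> = src G \<beta> \<Longrightarrow>
        tgt G (cmp G \<beta> \<alpha>) = tgt G \<beta>"
    and cmp_idt_right: "\<alpha> \<in> arr G \<Longrightarrow> cmp G \<alpha> (idt G (src G \<alpha>)) = \<alpha>"
    and cmp_idt_left: "\<alpha> \<in> arr G \<Longrightarrow> cmp G (idt G (tgt G \<alpha>)) \<alpha> = \<alpha>"
    and cmp_assoc: "\<alpha> \<in> arr G \<Longrightarrow> \<beta> \<in> arr G \<Longrightarrow> \<gamma> \<in> arr G \<Longrightarrow>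
        tgt G \<alpha> = src G \<beta> \<Longrightarrow> tgt G \<beta> = src G \<gamma> \<Longrightarrow>
        cmp G \<gamma> (cmp G \<beta> \<alpha>) = cmp G (cmp G \<gamma> \<beta>) \<alpha>"
    and invertible: "\<alpha> \<in> arr G \<Longrightarrow>
        \<exists>\<beta>\<in>arr G. src G \<beta> = tgt G \<alpha> \<and> tgt G \<beta> = src G \<alpha> \<and>
          cmp G \<beta> \<alpha> = idt G (src G \<alpha>) \<and> cmp G \<alpha> \<beta> = idt G (tgt G \<alpha>)"

definition out_arrows :: "('o, 'g) category_data \<Rightarrow> 'o \<Rightarrow> 'g set" where
  "out_arrows G a = {\<alpha> \<in> arr G. src G \<alpha> = a}"

text \<open>The spaces \<open>V \<alpha>\<close> are subspaces of one vector space \<^typ>\<open>'v\<close>; this is only a common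
  universe for them, no relation between different \<open>V \<alpha>\<close> is assumed (they may overlap or
  coincide).\<close>

definition graded_space_finite_type ::
  "('o, 'g) category_data \<Rightarrow> ('g \<Rightarrow> 'v::complex_vector set) \<Rightarrow> bool" where
  "graded_space_finite_type G V \<longleftrightarrow>
     (\<forall>\<alpha>\<in>arr G. cvec.subspace (V \<alpha>) \<and> (\<exists>B. finite B \<and> V \<alpha> = cvec.span B)) \<and>
     (\<forall>a\<in>obj G. finite {\<alpha> \<in> arr G. (src G \<alpha> = a \<or> tgt G \<alpha> = a) \<and> V \<alpha> \<noteq> {0}})"

text \<open>External direct sums are formed inside \<open>'g \<Rightarrow>\<^sub>0 'v\<close>: \<open>homog V \<alpha>\<close> is the copy of \<open>V \<alpha>\<close> in
  the summand indexed by \<open>\<alpha>\<close>. Hence the family \<open>homog V\<close> is independent, and so are the families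
  produced from it by \<open>graded_tensor\<close>; for independent families a direct sum is the span of the
  union, which is how \<open>\<Oplus>\<close> is rendered in the next two definitions.\<close>

definition homog :: "('g \<Rightarrow> 'v::complex_vector set) \<Rightarrow> 'g \<Rightarrow> ('g \<Rightarrow>\<^sub>0 'v) set" where
  "homog V \<alpha> = Poly_Mapping.single \<alpha> ` V \<alpha>"

definition graded_tensor ::
  "('o, 'g) category_data \<Rightarrow> ('g \<Rightarrow> 'a::complex_vector set) \<Rightarrow> ('g \<Rightarrow> 'b::complex_vector set)
     \<Rightarrow> 'g \<Rightarrow> ('a, 'b) tensor set" where
  "graded_tensor G A B \<gamma> = cvec.span {u \<otimes> v | u v \<alpha> \<beta>.
     \<alpha> \<in> arr G \<and> \<beta> \<in> arr G \<and> tgt G \<alpha> = src G \<beta> \<and> cmp G \<beta> \<alpha> = \<gamma> \<and> u \<in> A \<alpha> \<and> v \<in> B \<beta>}"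

definition source_sum ::
  "('o, 'g) category_data \<Rightarrow> ('g \<Rightarrow> 'a::complex_vector set) \<Rightarrow> 'o \<Rightarrow> 'a set" where
  "source_sum G W a = cvec.span (\<Union>\<alpha>\<in>out_arrows G a. W \<alpha>)"

type_synonym ('g, 'v) total2 = "('g \<Rightarrow>\<^sub>0 'v, 'g \<Rightarrow>\<^sub>0 'v) tensor"
type_synonym ('g, 'v) total3 = "('g \<Rightarrow>\<^sub>0 'v, ('g \<Rightarrow>\<^sub>0 'v, 'g \<Rightarrow>\<^sub>0 'v) tensor) tensor"

abbreviation VV ::
  "('o, 'g) category_data \<Rightarrow> ('g \<Rightarrow> 'v::complex_vector set) \<Rightarrow> 'g \<Rightarrow> ('g, 'v) total2 set" where
  "VV G V \<equiv> graded_tensor G (homog V) (homog V)"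

abbreviation VVV ::
  "('o, 'g) category_data \<Rightarrow> ('g \<Rightarrow> 'v::complex_vector set) \<Rightarrow> 'g \<Rightarrow> ('g, 'v) total3 set" where
  "VVV G V \<equiv> graded_tensor G (homog V) (VV G V)"

text \<open>An element of \<open>\<Oplus>\<^sub>\<alpha> End (W \<alpha>)\<close>, \<open>\<alpha>\<close> running over the arrows with source \<open>a\<close>, regarded as
  a degree preserving endomorphism of \<open>\<Oplus>\<^sub>\<alpha> W \<alpha>\<close>. Values of \<open>X\<close> off that space are irrelevant.\<close>

definition source_End ::
  "('o, 'g) category_data \<Rightarrow> ('g \<Rightarrow> 'a::complex_vector set) \<Rightarrow> 'o \<Rightarrow> ('a \<Rightarrow> 'a) set" where
  "source_End G W a = {X. clinear_on (source_sum G W a) X \<and>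
     (\<forall>\<alpha>\<in>out_arrows G a. X ` W \<alpha> \<subseteq> W \<alpha>) \<and>
     finite {\<alpha> \<in> out_arrows G a. \<exists>\<xi>\<in>W \<alpha>. X \<xi> \<noteq> 0}}"


section \<open>The operators \<open>X\<close> on two of three tensor factors\<close>

text \<open>\<open>op12 G V X a\<close> is \<open>X\<^sup>(\<^sup>1\<^sup>2\<^sup>)(a)\<close> and \<open>op23 G V X a\<close> is \<open>X\<^sup>(\<^sup>2\<^sup>3\<^sup>)(a h\<^sup>(\<^sup>1\<^sup>))\<close>. The defining
  equations determine them on \<open>source_sum G (VVV G V) a\<close>; existence is shown in \<open>op12_tensor\<close>
  and \<open>op23_tensor\<close> below.\<close>

definition op12 ::
  "('o, 'g) category_data \<Rightarrow> ('g \<Rightarrow> 'v::complex_vector set)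
     \<Rightarrow> ('o \<Rightarrow> ('g, 'v) total2 \<Rightarrow> ('g, 'v) total2) \<Rightarrow> 'o \<Rightarrow> ('g, 'v) total3 \<Rightarrow> ('g, 'v) total3" where
  "op12 G V X a = (SOME F. clinear F \<and>
     (\<forall>\<alpha>\<^sub>1\<in>arr G. \<forall>\<alpha>\<^sub>2\<in>arr G. \<forall>\<alpha>\<^sub>3\<in>arr G.
        src G \<alpha>\<^sub>1 = a \<and> tgt G \<alpha>\<^sub>1 = src G \<alpha>\<^sub>2 \<and> tgt G \<alpha>\<^sub>2 = src G \<alpha>\<^sub>3 \<longrightarrow>
        (\<forall>u\<in>homog V \<alpha>\<^sub>1. \<forall>v\<in>homog V \<alpha>\<^sub>2. \<forall>w\<in>homog V \<alpha>\<^sub>3.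
           F (u \<otimes> (v \<otimes> w)) = tensor_assoc (X a (u \<otimes> v) \<otimes> w))))"

definition op23 ::
  "('o, 'g) category_data \<Rightarrow> ('g \<Rightarrow> 'v::complex_vector set)
     \<Rightarrow> ('o \<Rightarrow> ('g, 'v) total2 \<Rightarrow> ('g, 'v) total2) \<Rightarrow> 'o \<Rightarrow> ('g, 'v) total3 \<Rightarrow> ('g, 'v) total3" where
  "op23 G V X a = (SOME F. clinear F \<and>
     (\<forall>\<alpha>\<^sub>1\<in>arr G. \<forall>\<alpha>\<^sub>2\<in>arr G. \<forall>\<alpha>\<^sub>3\<in>arr G.
        src G \<alpha>\<^sub>1 = a \<and> tgt G \<alpha>\<^sub>1 = src G \<alpha>\<^sub>2 \<and> tgt G \<alpha>\<^sub>2 = src G \<alpha>\<^sub>3 \<longrightarrow>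
        (\<forall>u\<in>homog V \<alpha>\<^sub>1. \<forall>v\<in>homog V \<alpha>\<^sub>2. \<forall>w\<in>homog V \<alpha>\<^sub>3.
           F (u \<otimes> (v \<otimes> w)) = u \<otimes> X (tgt G \<alpha>\<^sub>1) (v \<otimes> w))))"

lemma clinear_on_extend:
  assumes S: "cvec.subspace S" and f: "clinear_on S f"
  obtains g where "clinear g" "\<And>x. x \<in> S \<Longrightarrow> g x = f x"
proof -
  obtain B where B: "B \<subseteq> S" "cvec.independent B" "S \<subseteq> cvec.span B"
    using cvec.maximal_independent_subset by blast
  obtain g where g: "clinear g" "\<forall>x\<in>B. g x = f x"
    using cvec_pair.linear_independent_extend[OF B(2)] by blast
  have "x \<in> S \<and> g x = f x" if "x \<in> cvec.span B" for x
    using that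
  proof (induction rule: cvec.span_induct_alt)
    case base
    have "f 0 = 0"
      using f cvec.subspace_0[OF S] unfolding clinear_on_def by (metis cvec.scale_zero_left)
    then show ?case using cvec.subspace_0[OF S] cvec_pair.linear_0[OF g(1)] by simp
  next
    case (step c x y)
    then have "x \<in> S" "c *\<^sub>C x \<in> S" "y \<in> S"
      using B(1) cvec.subspace_scale[OF S] by auto
    then show ?case
      using f step g(2) cvec.subspace_add[OF S]
      by (simp add: clinear_on_def cvec_pair.linear_add[OF g(1)] cvec_pair.linear_scale[OF g(1)])
  qed
  then show ?thesis using that[OF g(1)] B(3) by blast
qed

lemma (in groupoid) tensor_in_source_sum:
  assumes "\<alpha> \<in> arr G" "\<beta> \<in> arr G" "tgt G \<alpha> = src G \<beta>" "u \<in> A \<alpha>" "v \<in> B \<beta>"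
  shows "u \<otimes> v \<in> source_sum G (graded_tensor G A B) (src G \<alpha>)"
proof -
  have "u \<otimes> v \<in> graded_tensor G A B (cmp G \<beta> \<alpha>)"
    unfolding graded_tensor_def by (rule cvec.span_base) (use assms in blast)
  moreover have "cmp G \<beta> \<alpha> \<in> out_arrows G (src G \<alpha>)"
    using assms by (simp add: out_arrows_def cmp_arr src_cmp)
  ultimately show ?thesis
    unfolding source_sum_def by (intro cvec.span_base) blast
qed

lemma (in groupoid)
  fixes V :: "'g \<Rightarrow> 'v::complex_vector set"
  assumes X: "clinear_on (source_sum G (VV G V) a) (X a)"
  shows clinear_op12: "clinear (op12 G V X a)"
    and op12_tensor: "\<lbrakk>\<alpha>\<^sub>1 \<in> arr G; \<alpha>\<^sub>2 \<in> arr G; \<alpha>\<^sub>3 \<in> arr G; src G \<alpha>\<^sub>1 = a;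
        tgt G \<alpha>\<^sub>1 = src G \<alpha>\<^sub>2; tgt G \<alpha>\<^sub>2 = src G \<alpha>\<^sub>3;
        u \<in> homog V \<alpha>\<^sub>1; v \<in> homog V \<alpha>\<^sub>2; w \<in> homog V \<alpha>\<^sub>3\<rbrakk> \<Longrightarrow>
      op12 G V X a (u \<otimes> (v \<otimes> w)) = tensor_assoc (X a (u \<otimes> v) \<otimes> w)"
proof -
  obtain g where g: "clinear g" "\<And>p. p \<in> source_sum G (VV G V) a \<Longrightarrow> g p = X a p"
    using clinear_on_extend[OF _ X] by (auto simp: source_sum_def)
  define h where "h u v w = tensor_assoc (g (u \<otimes> v) \<otimes> w)" for u v and w :: "'g \<Rightarrow>\<^sub>0 'v"
  note [simp] = tensor_add_left tensor_add_right tensor_scaleC_left tensor_scaleC_right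
    cvec_pair.linear_add[OF g(1)] cvec_pair.linear_scale[OF g(1)]
    cvec_pair.linear_add[OF clinear_tensor_assoc] cvec_pair.linear_scale[OF clinear_tensor_assoc]
  have h: "cbilinear (h u)" "clinear (\<lambda>u. h u v w)" for u v w
    by (auto simp: h_def cbilinear_def intro!: clinearI)
  have b: "cbilinear (\<lambda>u q. tensor_lift (h u) q)"
    using cbilinear_tensor_lift[of h, OF h] by (auto simp: cbilinear_def)
  define F where "F = tensor_lift (\<lambda>u q. tensor_lift (h u) q)"
  have "clinear F" "F (u \<otimes> (v \<otimes> w)) = tensor_assoc (g (u \<otimes> v) \<otimes> w)" for u v w
    using clinear_tensor_lift[OF b] tensor_lift_tensor[OF b] tensor_lift_tensor[OF h(1)]
    by (simp_all add: F_def h_def)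
  then have "clinear F \<and> (\<forall>\<alpha>\<^sub>1\<in>arr G. \<forall>\<alpha>\<^sub>2\<in>arr G. \<forall>\<alpha>\<^sub>3\<in>arr G.
        src G \<alpha>\<^sub>1 = a \<and> tgt G \<alpha>\<^sub>1 = src G \<alpha>\<^sub>2 \<and> tgt G \<alpha>\<^sub>2 = src G \<alpha>\<^sub>3 \<longrightarrow>
        (\<forall>u\<in>homog V \<alpha>\<^sub>1. \<forall>v\<in>homog V \<alpha>\<^sub>2. \<forall>w\<in>homog V \<alpha>\<^sub>3.
           F (u \<otimes> (v \<otimes> w)) = tensor_assoc (X a (u \<otimes> v) \<otimes> w)))"
    using g(2) tensor_in_source_sum[where A = "homog V" and B = "homog V"] by auto
  from someI[of "\<lambda>F. clinear F \<and> (\<forall>\<alpha>\<^sub>1\<in>arr G. \<forall>\<alpha>\<^sub>2\<in>arr G. \<forall>\<alpha>\<^sub>3\<in>arr G.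
        src G \<alpha>\<^sub>1 = a \<and> tgt G \<alpha>\<^sub>1 = src G \<alpha>\<^sub>2 \<and> tgt G \<alpha>\<^sub>2 = src G \<alpha>\<^sub>3 \<longrightarrow>
        (\<forall>u\<in>homog V \<alpha>\<^sub>1. \<forall>v\<in>homog V \<alpha>\<^sub>2. \<forall>w\<in>homog V \<alpha>\<^sub>3.
           F (u \<otimes> (v \<otimes> w)) = tensor_assoc (X a (u \<otimes> v) \<otimes> w)))", OF this, folded op12_def]
  show "clinear (op12 G V X a)"
    and "\<lbrakk>\<alpha>\<^sub>1 \<in> arr G; \<alpha>\<^sub>2 \<in> arr G; \<alpha>\<^sub>3 \<in> arr G; src G \<alpha>\<^sub>1 = a;
        tgt G \<alpha>\<^sub>1 = src G \<alpha>\<^sub>2; tgt G \<alpha>\<^sub>2 = src G \<alpha>\<^sub>3;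
        u \<in> homog V \<alpha>\<^sub>1; v \<in> homog V \<alpha>\<^sub>2; w \<in> homog V \<alpha>\<^sub>3\<rbrakk> \<Longrightarrow>
      op12 G V X a (u \<otimes> (v \<otimes> w)) = tensor_assoc (X a (u \<otimes> v) \<otimes> w)"
    by blast+
qed

lemma (in groupoid)
  fixes V :: "'g \<Rightarrow> 'v::complex_vector set"
  assumes X: "\<And>b. b \<in> obj G \<Longrightarrow> clinear_on (source_sum G (VV G V) b) (X b)"
  shows clinear_op23: "clinear (op23 G V X a)"
    and op23_tensor: "\<lbrakk>\<alpha>\<^sub>1 \<in> arr G; \<alpha>\<^sub>2 \<in> arr G; \<alpha>\<^sub>3 \<in> arr G; src G \<alpha>\<^sub>1 = a;
        tgt G \<alpha>\<^sub>1 = src G \<alpha>\<^sub>2; tgt G \<alpha>\<^sub>2 = src G \<alpha>\<^sub>3;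
        u \<in> homog V \<alpha>\<^sub>1; v \<in> homog V \<alpha>\<^sub>2; w \<in> homog V \<alpha>\<^sub>3\<rbrakk> \<Longrightarrow>
      op23 G V X a (u \<otimes> (v \<otimes> w)) = u \<otimes> X (tgt G \<alpha>\<^sub>1) (v \<otimes> w)"
proof -
  have "\<exists>g. clinear g \<and> (b \<in> obj G \<longrightarrow> (\<forall>p\<in>source_sum G (VV G V) b. g p = X b p))" for b
  proof (cases "b \<in> obj G")
    case True
    show ?thesis
      using clinear_on_extend[OF _ X[OF True]]
      by (metis cvec.subspace_span source_sum_def)
  qed (auto intro!: exI[of _ "\<lambda>_. 0"] clinearI)
  then obtain g where g: "\<And>b. clinear (g b)"
    "\<And>b p. b \<in> obj G \<Longrightarrow> p \<in> source_sum G (VV G V) b \<Longrightarrow> g b p = X b p" by metis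
  define h where "h x q = (\<Sum>\<alpha>\<in>Poly_Mapping.keys x.
      Poly_Mapping.single \<alpha> (Poly_Mapping.lookup x \<alpha>) \<otimes> g (tgt G \<alpha>) q)"
    for x :: "'g \<Rightarrow>\<^sub>0 'v" and q
  note [simp] = tensor_add_left tensor_add_right tensor_scaleC_left tensor_scaleC_right
    cvec_pair.linear_add[OF g(1)] cvec_pair.linear_scale[OF g(1)]
  have z: "0 \<otimes> t = 0" for t :: "('g, 'v) total2"
    using tensor_scaleC_left[of 0 0 t] by simp
  have hs: "h x q = (\<Sum>\<alpha>\<in>S. Poly_Mapping.single \<alpha> (Poly_Mapping.lookup x \<alpha>) \<otimes> g (tgt G \<alpha>) q)"
    if "finite S" "Poly_Mapping.keys x \<subseteq> S" for x q S
    unfolding h_def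
    by (rule sum.mono_neutral_left) (use that in \<open>auto simp: in_keys_iff z\<close>)
  have "h (x + y) q = h x q + h y q" for x y q
  proof -
    let ?S = "Poly_Mapping.keys x \<union> Poly_Mapping.keys y"
    have "h (x + y) q = (\<Sum>\<alpha>\<in>?S.
        Poly_Mapping.single \<alpha> (Poly_Mapping.lookup (x + y) \<alpha>) \<otimes> g (tgt G \<alpha>) q)"
      by (rule hs) (simp_all add: Poly_Mapping.keys_add)
    then show ?thesis
      by (simp add: hs[of ?S x] hs[of ?S y] lookup_add single_add sum.distrib)
  qed
  moreover have "h (c *\<^sub>C x) q = c *\<^sub>C h x q" for c x q
  proof -
    have "h (c *\<^sub>C x) q = (\<Sum>\<alpha>\<in>Poly_Mapping.keys x.
        Poly_Mapping.single \<alpha> (Poly_Mapping.lookup (c *\<^sub>C x) \<alpha>) \<otimes> g (tgt G \<alpha>) q)"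
      by (rule hs) (auto simp: in_keys_iff)
    then show ?thesis by (simp add: h_def single_scaleC cvec.scale_sum_right)
  qed
  moreover have "clinear (h x)" for x
    by (rule clinearI) (simp_all add: h_def sum.distrib cvec.scale_sum_right)
  ultimately have b: "cbilinear h"
    by (auto simp: cbilinear_def intro: clinearI)
  have hom: "h u q = u \<otimes> g (tgt G \<alpha>) q" if "u \<in> homog V \<alpha>" for u q \<alpha>
    using that hs[of "{\<alpha>}" u q] by (auto simp: homog_def)
  define F where "F = tensor_lift h"
  have "clinear F" "F (u \<otimes> q) = h u q" for u q
    using clinear_tensor_lift[OF b] tensor_lift_tensor[OF b] by (simp_all add: F_def)
  then have "clinear F \<and> (\<forall>\<alpha>\<^sub>1\<in>arr G. \<forall>\<alpha>\<^sub>2\<in>arr G. \<forall>\<alpha>\<^sub>3\<in>arr G.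
        src G \<alpha>\<^sub>1 = a \<and> tgt G \<alpha>\<^sub>1 = src G \<alpha>\<^sub>2 \<and> tgt G \<alpha>\<^sub>2 = src G \<alpha>\<^sub>3 \<longrightarrow>
        (\<forall>u\<in>homog V \<alpha>\<^sub>1. \<forall>v\<in>homog V \<alpha>\<^sub>2. \<forall>w\<in>homog V \<alpha>\<^sub>3.
           F (u \<otimes> (v \<otimes> w)) = u \<otimes> X (tgt G \<alpha>\<^sub>1) (v \<otimes> w)))"
    using g(2) tensor_in_source_sum[where A = "homog V" and B = "homog V"] src_obj
    by (auto simp: hom)
  from someI[of "\<lambda>F. clinear F \<and> (\<forall>\<alpha>\<^sub>1\<in>arr G. \<forall>\<alpha>\<^sub>2\<in>arr G. \<forall>\<alpha>\<^sub>3\<in>arr G.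
        src G \<alpha>\<^sub>1 = a \<and> tgt G \<alpha>\<^sub>1 = src G \<alpha>\<^sub>2 \<and> tgt G \<alpha>\<^sub>2 = src G \<alpha>\<^sub>3 \<longrightarrow>
        (\<forall>u\<in>homog V \<alpha>\<^sub>1. \<forall>v\<in>homog V \<alpha>\<^sub>2. \<forall>w\<in>homog V \<alpha>\<^sub>3.
           F (u \<otimes> (v \<otimes> w)) = u \<otimes> X (tgt G \<alpha>\<^sub>1) (v \<otimes> w)))", OF this, folded op23_def]
  show "clinear (op23 G V X a)"
    and "\<lbrakk>\<alpha>\<^sub>1 \<in> arr G; \<alpha>\<^sub>2 \<in> arr G; \<alpha>\<^sub>3 \<in> arr G; src G \<alpha>\<^sub>1 = a;
        tgt G \<alpha>\<^sub>1 = src G \<alpha>\<^sub>2; tgt G \<alpha>\<^sub>2 = src G \<alpha>\<^sub>3;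
        u \<in> homog V \<alpha>\<^sub>1; v \<in> homog V \<alpha>\<^sub>2; w \<in> homog V \<alpha>\<^sub>3\<rbrakk> \<Longrightarrow>
      op23 G V X a (u \<otimes> (v \<otimes> w)) = u \<otimes> X (tgt G \<alpha>\<^sub>1) (v \<otimes> w)"
    by blast+
qed


section \<open>Local dynamical Temperley--Lieb operators\<close>

definition local_dynamical_TL ::
  "('o, 'g) category_data \<Rightarrow> ('g \<Rightarrow> 'v::complex_vector set) \<Rightarrow> ('o \<Rightarrow> complex)
     \<Rightarrow> ('o \<Rightarrow> ('g, 'v) total2 \<Rightarrow> ('g, 'v) total2) \<Rightarrow> bool" where
  "local_dynamical_TL G V \<kappa> T \<longleftrightarrow> (\<forall>a\<in>obj G.
     T a \<in> source_End G (VV G V) a \<and>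
     (\<forall>\<xi>\<in>source_sum G (VV G V) a. T a (T a \<xi>) = \<kappa> a *\<^sub>C T a \<xi>) \<and>
     (\<forall>\<xi>\<in>source_sum G (VVV G V) a.
        op12 G V T a (op23 G V T a (op12 G V T a \<xi>)) = op12 G V T a \<xi>) \<and>
     (\<forall>\<xi>\<in>source_sum G (VVV G V) a.
        op23 G V T a (op12 G V T a (op23 G V T a \<xi>)) = op23 G V T a \<xi>))"

definition R_check ::
  "('o \<Rightarrow> ('g, 'v::complex_vector) total2 \<Rightarrow> ('g, 'v) total2) \<Rightarrow> complex
     \<Rightarrow> 'o \<Rightarrow> ('g, 'v) total2 \<Rightarrow> ('g, 'v) total2" where
  "R_check T x a \<xi> = \<xi> + x *\<^sub>C T a \<xi>"

end

theory Submission
  imports Defs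
begin

text \<open>
  Fix an object \<open>a\<close> and write \<open>A\<close> for \<open>T\<^sup>(\<^sup>1\<^sup>2\<^sup>)(a)\<close> and \<open>B\<close> for \<open>T\<^sup>(\<^sup>2\<^sup>3\<^sup>)(a h\<^sup>(\<^sup>1\<^sup>))\<close>, acting on
  the part of \<open>V \<otimes> V \<otimes> V\<close> with source \<open>a\<close>. The operators in the equation are of the form \<open>1 + x A\<close>
  and \<open>1 + x B\<close> (\<open>op12_R_check\<close>, \<open>op23_R_check\<close>), so its two sides are
  \<open>(1 + x B) (1 + x' A) (1 + x'' B)\<close> and \<open>(1 + x'' A) (1 + x' B) (1 + x A)\<close>. Expanding them with
  \<open>B A B = B\<close> and \<open>A B A = A\<close>, the terms in \<open>1\<close>, \<open>A B\<close> and \<open>B A\<close> agree, and it is enough that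
  \<open>(x + x'' + x x' x'') B + x x'' B\<^sup>2 = x' B\<close> and that the same identity holds for \<open>A\<close>
  (\<open>Temperley_Lieb_Yang_Baxter\<close>).

  The squares carry the dynamics: \<open>A\<^sup>2 = \<kappa>(a) A\<close>, whereas on \<open>V\<^sub>\<alpha> \<otimes> V \<otimes> V\<close> one has
  \<open>B\<^sup>2 = \<kappa>(t(\<alpha>)) B\<close>, because \<open>T\<close> is then evaluated at the target of the first arrow and \<open>B\<close> leaves
  that arrow unchanged (\<open>op12_T_triple\<close>, \<open>op23_T_triple\<close>). Hence both identities follow from
  \<open>x + x'' (1 + k x + x x') = x'\<close>, with \<open>k = \<kappa>(a)\<close> for \<open>A\<close> and \<open>k = \<kappa>(t(\<alpha>))\<close> for \<open>B\<close>; these are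
  the two equations assumed for \<open>x''\<close>.

  Since the operators on three factors are prescribed only on products of homogeneous vectors with
  composable degrees, the remaining work is to see that the part with source \<open>a\<close> is spanned by
  these products and that \<open>A\<close> and \<open>B\<close> map their span to itself.
\<close>

section \<open>The span of composable triple products\<close>

lemma clinear_tensor_left: "clinear (\<lambda>u. u \<otimes> v)"
  and clinear_tensor_right: "clinear (\<lambda>v. u \<otimes> v)"
  using cbilinear_tensor_of unfolding cbilinear_def by blast+

lemma clinear_image_span:
  assumes "clinear F" "x \<in> cvec.span B" "\<And>b. b \<in> B \<Longrightarrow> F b \<in> cvec.span C"
  shows "F x \<in> cvec.span C"
proof -
  have "F x \<in> cvec.span (F ` B)"
    using assms(2) by (auto simp: cvec_pair.linear_span_image[OF assms(1)])
  also have "\<dots> \<subseteq> cvec.span C"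
    by (rule cvec.span_minimal) (use assms(3) in auto)
  finally show ?thesis .
qed

lemma clinear_ident: "clinear (\<lambda>p. p)"
  by (rule clinearI) simp_all

lemma clinear_compose: "clinear F \<Longrightarrow> clinear F' \<Longrightarrow> clinear (\<lambda>p. F' (F p))"
  using Vector_Spaces.linear_compose by (auto simp: o_def)

lemma clinear_add_scaled:
  assumes "clinear F" "clinear F'"
  shows "clinear (\<lambda>p. F p + c *\<^sub>C F' p)"
  by (intro cvec_pair.linear_compose_add cvec_pair.linear_compose_scale_right assms)

definition composable_triple ::
  "('o, 'g) category_data \<Rightarrow> ('g \<Rightarrow> 'v::complex_vector set) \<Rightarrow> 'o
     \<Rightarrow> 'g \<Rightarrow> 'g \<Rightarrow> 'g \<Rightarrow> ('g \<Rightarrow>\<^sub>0 'v) \<Rightarrow> ('g \<Rightarrow>\<^sub>0 'v) \<Rightarrow> ('g \<Rightarrow>\<^sub>0 'v) \<Rightarrow> bool" where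
  "composable_triple G V a \<alpha>\<^sub>1 \<alpha>\<^sub>2 \<alpha>\<^sub>3 u v w \<longleftrightarrow>
     \<alpha>\<^sub>1 \<in> arr G \<and> \<alpha>\<^sub>2 \<in> arr G \<and> \<alpha>\<^sub>3 \<in> arr G \<and>
     src G \<alpha>\<^sub>1 = a \<and> tgt G \<alpha>\<^sub>1 = src G \<alpha>\<^sub>2 \<and> tgt G \<alpha>\<^sub>2 = src G \<alpha>\<^sub>3 \<and>
     u \<in> homog V \<alpha>\<^sub>1 \<and> v \<in> homog V \<alpha>\<^sub>2 \<and> w \<in> homog V \<alpha>\<^sub>3"

definition triple_products ::
  "('o, 'g) category_data \<Rightarrow> ('g \<Rightarrow> 'v::complex_vector set) \<Rightarrow> 'o \<Rightarrow> ('g, 'v) total3 set" where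
  "triple_products G V a =
     {u \<otimes> (v \<otimes> w) | u v w \<alpha>\<^sub>1 \<alpha>\<^sub>2 \<alpha>\<^sub>3. composable_triple G V a \<alpha>\<^sub>1 \<alpha>\<^sub>2 \<alpha>\<^sub>3 u v w}"

lemma triple_productE:
  assumes "p \<in> triple_products G V a"
  obtains u v w \<alpha>\<^sub>1 \<alpha>\<^sub>2 \<alpha>\<^sub>3
  where "p = u \<otimes> (v \<otimes> w)" "composable_triple G V a \<alpha>\<^sub>1 \<alpha>\<^sub>2 \<alpha>\<^sub>3 u v w"
  using assms unfolding triple_products_def by blast

context groupoid
begin

lemma product_in_graded_tensor:
  assumes "\<alpha> \<in> arr G" "\<beta> \<in> arr G" "tgt G \<alpha> = src G \<beta>" "u \<in> A \<alpha>" "v \<in> B \<beta>"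
  shows "u \<otimes> v \<in> graded_tensor G A B (cmp G \<beta> \<alpha>)"
  unfolding graded_tensor_def by (rule cvec.span_base) (use assms in blast)

lemma homogeneous_in_source_sum:
  assumes "\<gamma> \<in> arr G" "p \<in> W \<gamma>"
  shows "p \<in> source_sum G W (src G \<gamma>)"
  unfolding source_sum_def by (rule cvec.span_base) (use assms in \<open>auto simp: out_arrows_def\<close>)

lemma tensor_VV_in_span:
  assumes "\<alpha> \<in> arr G" "\<beta> \<in> arr G" "src G \<alpha> = a" "tgt G \<alpha> = src G \<beta>"
    and "u \<in> homog V \<alpha>" "q \<in> VV G V \<beta>"
  shows "u \<otimes> q \<in> cvec.span (triple_products G V a)"
  using clinear_tensor_right assms(6)[unfolded graded_tensor_def]
proof (rule clinear_image_span)
  fix b assume "b \<in> {v \<otimes> w | v w \<alpha>' \<beta>'. \<alpha>' \<in> arr G \<and> \<beta>' \<in> arr G \<and> tgt G \<alpha>' = src G \<beta>' \<and>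
      cmp G \<beta>' \<alpha>' = \<beta> \<and> v \<in> homog V \<alpha>' \<and> w \<in> homog V \<beta>'}"
  then obtain v w \<alpha>' \<beta>' where b: "b = v \<otimes> w" "\<alpha>' \<in> arr G" "\<beta>' \<in> arr G" "tgt G \<alpha>' = src G \<beta>'"
    "cmp G \<beta>' \<alpha>' = \<beta>" "v \<in> homog V \<alpha>'" "w \<in> homog V \<beta>'" by blast
  then have "composable_triple G V a \<alpha> \<alpha>' \<beta>' u v w"
    using assms src_cmp[of \<alpha>' \<beta>'] by (auto simp: composable_triple_def)
  then show "u \<otimes> b \<in> cvec.span (triple_products G V a)"
    unfolding triple_products_def b(1) by (intro cvec.span_base) blast
qed

lemma assoc_VV_tensor_in_span:
  assumes "\<beta> \<in> arr G" "\<gamma> \<in> arr G" "src G \<beta> = a" "tgt G \<beta> = src G \<gamma>"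
    and "p \<in> VV G V \<beta>" "w \<in> homog V \<gamma>"
  shows "tensor_assoc (p \<otimes> w) \<in> cvec.span (triple_products G V a)"
  using clinear_compose[OF clinear_tensor_left clinear_tensor_assoc]
    assms(5)[unfolded graded_tensor_def]
proof (rule clinear_image_span)
  fix b assume "b \<in> {u \<otimes> v | u v \<alpha>' \<beta>'. \<alpha>' \<in> arr G \<and> \<beta>' \<in> arr G \<and> tgt G \<alpha>' = src G \<beta>' \<and>
      cmp G \<beta>' \<alpha>' = \<beta> \<and> u \<in> homog V \<alpha>' \<and> v \<in> homog V \<beta>'}"
  then obtain u v \<alpha>' \<beta>' where b: "b = u \<otimes> v" "\<alpha>' \<in> arr G" "\<beta>' \<in> arr G" "tgt G \<alpha>' = src G \<beta>'"
    "cmp G \<beta>' \<alpha>' = \<beta>" "u \<in> homog V \<alpha>'" "v \<in> homog V \<beta>'" by blast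
  then have "composable_triple G V a \<alpha>' \<beta>' \<gamma> u v w"
    using assms src_cmp[of \<alpha>' \<beta>'] tgt_cmp[of \<alpha>' \<beta>'] by (auto simp: composable_triple_def)
  then show "tensor_assoc (b \<otimes> w) \<in> cvec.span (triple_products G V a)"
    unfolding triple_products_def b(1) tensor_assoc_tensor by (intro cvec.span_base) blast
qed

lemma source_sum_VVV_subset_span:
  "source_sum G (VVV G V) a \<subseteq> cvec.span (triple_products G V a)"
proof -
  have "VVV G V \<gamma> \<subseteq> cvec.span (triple_products G V a)" if "\<gamma> \<in> out_arrows G a" for \<gamma>
    unfolding graded_tensor_def[of G "homog V" "VV G V"]
  proof (rule cvec.span_minimal)
    show "{u \<otimes> q | u q \<alpha> \<beta>. \<alpha> \<in> arr G \<and> \<beta> \<in> arr G \<and> tgt G \<alpha> = src G \<beta> \<and> cmp G \<beta> \<alpha> = \<gamma> \<and>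
        u \<in> homog V \<alpha> \<and> q \<in> VV G V \<beta>} \<subseteq> cvec.span (triple_products G V a)"
      using that tensor_VV_in_span[where a = a and V = V] by (auto simp: out_arrows_def src_cmp)
  qed simp
  then show ?thesis
    unfolding source_sum_def by (intro cvec.span_minimal) auto
qed

section \<open>The operators on two of three factors\<close>

text \<open>The operators are prescribed on elementary tensors only; squaring them requires their values
  when the pair of factors acted on is an arbitrary, not necessarily decomposable, vector of
  homogeneous degree.\<close>

lemma op12_VV_tensor:
  fixes V :: "'g \<Rightarrow> 'v::complex_vector set"
  assumes X: "clinear_on (source_sum G (VV G V) a) (X a)"
    and arrs: "\<beta> \<in> arr G" "\<gamma> \<in> arr G" "src G \<beta> = a" "tgt G \<beta> = src G \<gamma>"
    and p: "p \<in> VV G V \<beta>" and w: "w \<in> homog V \<gamma>"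
  shows "op12 G V X a (tensor_assoc (p \<otimes> w)) = tensor_assoc (X a p \<otimes> w)"
proof -
  \<comment> \<open>\<open>X a\<close> is linear on a subspace only; a globally linear extension makes both sides of the claim
    linear maps of \<open>p\<close>, which may then be compared on generators.\<close>
  obtain g where g: "clinear g" "\<And>p. p \<in> source_sum G (VV G V) a \<Longrightarrow> g p = X a p"
    using clinear_on_extend[OF _ X] by (auto simp: source_sum_def)
  note aw = clinear_compose[OF clinear_tensor_left clinear_tensor_assoc]
  have "op12 G V X a (tensor_assoc (p \<otimes> w)) = tensor_assoc (g p \<otimes> w)"
    using clinear_compose[OF aw clinear_op12[where X = X, OF X]]
      clinear_compose[OF g(1) aw] p[unfolded graded_tensor_def]
  proof (rule cvec_pair.linear_eq_on)
    fix b assume "b \<in> {u \<otimes> v | u v \<alpha>' \<beta>'. \<alpha>' \<in> arr G \<and> \<beta>' \<in> arr G \<and> tgt G \<alpha>' = src G \<beta>' \<and>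
        cmp G \<beta>' \<alpha>' = \<beta> \<and> u \<in> homog V \<alpha>' \<and> v \<in> homog V \<beta>'}"
    then obtain u v \<alpha>' \<beta>' where b: "b = u \<otimes> v" "\<alpha>' \<in> arr G" "\<beta>' \<in> arr G" "tgt G \<alpha>' = src G \<beta>'"
      "cmp G \<beta>' \<alpha>' = \<beta>" "u \<in> homog V \<alpha>'" "v \<in> homog V \<beta>'" by blast
    have st: "src G \<alpha>' = a" "tgt G \<beta>' = src G \<gamma>"
      using b arrs src_cmp[of \<alpha>' \<beta>'] tgt_cmp[of \<alpha>' \<beta>'] by auto
    have "g b = X a b"
      using g(2) tensor_in_source_sum[where A = "homog V" and B = "homog V", of \<alpha>' \<beta>' u v] b st
      by auto
    then show "op12 G V X a (tensor_assoc (b \<otimes> w)) = tensor_assoc (g b \<otimes> w)"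
      using op12_tensor[where X = X, OF X b(2,3) arrs(2) st(1) b(4) st(2) b(6,7) w]
      by (simp add: b(1) tensor_assoc_tensor)
  qed
  moreover have "g p = X a p"
    using g(2) homogeneous_in_source_sum[where W = "VV G V", OF arrs(1) p] arrs(3) by simp
  ultimately show ?thesis by simp
qed

lemma op23_tensor_VV:
  fixes V :: "'g \<Rightarrow> 'v::complex_vector set"
  assumes X: "\<And>b. b \<in> obj G \<Longrightarrow> clinear_on (source_sum G (VV G V) b) (X b)"
    and arrs: "\<alpha> \<in> arr G" "\<beta> \<in> arr G" "src G \<alpha> = a" "tgt G \<alpha> = src G \<beta>"
    and u: "u \<in> homog V \<alpha>" and q: "q \<in> VV G V \<beta>"
  shows "op23 G V X a (u \<otimes> q) = u \<otimes> X (tgt G \<alpha>) q"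
proof -
  obtain g where g: "clinear g" "\<And>p. p \<in> source_sum G (VV G V) (tgt G \<alpha>) \<Longrightarrow> g p = X (tgt G \<alpha>) p"
    using clinear_on_extend[OF _ X[OF tgt_obj[OF arrs(1)]]] by (auto simp: source_sum_def)
  have "op23 G V X a (u \<otimes> q) = u \<otimes> g q"
    using clinear_compose[OF clinear_tensor_right clinear_op23[where X = X, OF X]]
      clinear_compose[OF g(1) clinear_tensor_right]
      q[unfolded graded_tensor_def]
  proof (rule cvec_pair.linear_eq_on)
    fix b assume "b \<in> {v \<otimes> w | v w \<alpha>' \<beta>'. \<alpha>' \<in> arr G \<and> \<beta>' \<in> arr G \<and> tgt G \<alpha>' = src G \<beta>' \<and>
        cmp G \<beta>' \<alpha>' = \<beta> \<and> v \<in> homog V \<alpha>' \<and> w \<in> homog V \<beta>'}"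
    then obtain v w \<alpha>' \<beta>' where b: "b = v \<otimes> w" "\<alpha>' \<in> arr G" "\<beta>' \<in> arr G" "tgt G \<alpha>' = src G \<beta>'"
      "cmp G \<beta>' \<alpha>' = \<beta>" "v \<in> homog V \<alpha>'" "w \<in> homog V \<beta>'" by blast
    have st: "tgt G \<alpha> = src G \<alpha>'"
      using b arrs src_cmp[of \<alpha>' \<beta>'] by auto
    have "g b = X (tgt G \<alpha>) b"
      using g(2) tensor_in_source_sum[where A = "homog V" and B = "homog V", of \<alpha>' \<beta>' v w] b st
      by auto
    then show "op23 G V X a (u \<otimes> b) = u \<otimes> g b"
      using op23_tensor[where X = X, OF X arrs(1) b(2,3) arrs(3) st b(4) u b(6,7)]
      by (simp add: b(1))
  qed auto
  moreover have "g q = X (tgt G \<alpha>) q"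
    using g(2) homogeneous_in_source_sum[where W = "VV G V", OF arrs(2) q] arrs(4) by simp
  ultimately show ?thesis by simp
qed

end

section \<open>The Temperley--Lieb relations on triple products\<close>

locale dynamical_TL = groupoid G for G :: "('o, 'g) category_data" +
  fixes V :: "'g \<Rightarrow> 'v::complex_vector set"
    and \<kappa> :: "'o \<Rightarrow> complex"
    and T :: "'o \<Rightarrow> ('g, 'v) total2 \<Rightarrow> ('g, 'v) total2"
  assumes TL: "local_dynamical_TL G V \<kappa> T"
begin

lemma T_clinear_on: "b \<in> obj G \<Longrightarrow> clinear_on (source_sum G (VV G V) b) (T b)"
  using TL by (auto simp: local_dynamical_TL_def source_End_def)

lemma T_VV: "\<gamma> \<in> arr G \<Longrightarrow> p \<in> VV G V \<gamma> \<Longrightarrow> T (src G \<gamma>) p \<in> VV G V \<gamma>"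
  using TL src_obj by (fastforce simp: local_dynamical_TL_def source_End_def out_arrows_def)

lemma T_square: "\<gamma> \<in> arr G \<Longrightarrow> p \<in> VV G V \<gamma> \<Longrightarrow>
    T (src G \<gamma>) (T (src G \<gamma>) p) = \<kappa> (src G \<gamma>) *\<^sub>C T (src G \<gamma>) p"
  using TL src_obj homogeneous_in_source_sum[where W = "VV G V"]
  by (auto simp: local_dynamical_TL_def)

lemma R_check_clinear_on:
  "b \<in> obj G \<Longrightarrow> clinear_on (source_sum G (VV G V) b) (R_check T y b)"
  using T_clinear_on[of b]
  by (simp add: clinear_on_def R_check_def scaleC_add_right scaleC_scaleC mult.commute)

lemma clinear_op12_T: "a \<in> obj G \<Longrightarrow> clinear (op12 G V T a)"
  by (rule clinear_op12[OF T_clinear_on])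

lemma clinear_op23_T: "clinear (op23 G V T a)"
  by (rule clinear_op23[OF T_clinear_on])

text \<open>On a triple product the operators reduce to \<open>T\<close> on two adjacent factors, which preserves the
  degree of that pair; this gives both their squares and the invariance of the span.\<close>

lemma op12_T_triple:
  assumes "composable_triple G V a \<alpha>\<^sub>1 \<alpha>\<^sub>2 \<alpha>\<^sub>3 u v w"
  shows "op12 G V T a (u \<otimes> (v \<otimes> w)) \<in> cvec.span (triple_products G V a)"
    and "op12 G V T a (op12 G V T a (u \<otimes> (v \<otimes> w))) = \<kappa> a *\<^sub>C op12 G V T a (u \<otimes> (v \<otimes> w))"
proof -
  let ?\<beta> = "cmp G \<alpha>\<^sub>2 \<alpha>\<^sub>1"
  have c: "\<alpha>\<^sub>1 \<in> arr G" "\<alpha>\<^sub>2 \<in> arr G" "\<alpha>\<^sub>3 \<in> arr G" "src G \<alpha>\<^sub>1 = a" "tgt G \<alpha>\<^sub>1 = src G \<alpha>\<^sub>2"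
    "tgt G \<alpha>\<^sub>2 = src G \<alpha>\<^sub>3" "u \<in> homog V \<alpha>\<^sub>1" "v \<in> homog V \<alpha>\<^sub>2" "w \<in> homog V \<alpha>\<^sub>3"
    using assms by (auto simp: composable_triple_def)
  have a: "a \<in> obj G" using c src_obj by auto
  have \<beta>: "?\<beta> \<in> arr G" "src G ?\<beta> = a" "tgt G ?\<beta> = src G \<alpha>\<^sub>3"
    using c by (auto simp: cmp_arr src_cmp tgt_cmp)
  have uv: "u \<otimes> v \<in> VV G V ?\<beta>" using c by (intro product_in_graded_tensor)
  have Tuv: "T a (u \<otimes> v) \<in> VV G V ?\<beta>" using T_VV[OF \<beta>(1) uv] \<beta>(2) by simp
  note eq = op12_VV_tensor[where X = T, OF T_clinear_on[OF a] \<beta>(1) c(3) \<beta>(2,3) _ c(9)]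
  have 1: "op12 G V T a (u \<otimes> (v \<otimes> w)) = tensor_assoc (T a (u \<otimes> v) \<otimes> w)"
    using eq[OF uv] by (simp add: tensor_assoc_tensor)
  then show "op12 G V T a (u \<otimes> (v \<otimes> w)) \<in> cvec.span (triple_products G V a)"
    using assoc_VV_tensor_in_span[OF \<beta>(1) c(3) \<beta>(2,3) Tuv c(9)] by simp
  show "op12 G V T a (op12 G V T a (u \<otimes> (v \<otimes> w))) = \<kappa> a *\<^sub>C op12 G V T a (u \<otimes> (v \<otimes> w))"
    using T_square[OF \<beta>(1) uv] \<beta>(2)
    by (simp add: 1 eq[OF Tuv] tensor_scaleC_left cvec_pair.linear_scale[OF clinear_tensor_assoc])
qed

lemma op23_T_triple:
  assumes "composable_triple G V a \<alpha>\<^sub>1 \<alpha>\<^sub>2 \<alpha>\<^sub>3 u v w"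
  shows "op23 G V T a (u \<otimes> (v \<otimes> w)) \<in> cvec.span (triple_products G V a)"
    and "op23 G V T a (op23 G V T a (u \<otimes> (v \<otimes> w))) = \<kappa> (tgt G \<alpha>\<^sub>1) *\<^sub>C op23 G V T a (u \<otimes> (v \<otimes> w))"
proof -
  let ?\<beta> = "cmp G \<alpha>\<^sub>3 \<alpha>\<^sub>2"
  have c: "\<alpha>\<^sub>1 \<in> arr G" "\<alpha>\<^sub>2 \<in> arr G" "\<alpha>\<^sub>3 \<in> arr G" "src G \<alpha>\<^sub>1 = a" "tgt G \<alpha>\<^sub>1 = src G \<alpha>\<^sub>2"
    "tgt G \<alpha>\<^sub>2 = src G \<alpha>\<^sub>3" "u \<in> homog V \<alpha>\<^sub>1" "v \<in> homog V \<alpha>\<^sub>2" "w \<in> homog V \<alpha>\<^sub>3"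
    using assms by (auto simp: composable_triple_def)
  have \<beta>: "?\<beta> \<in> arr G" "tgt G \<alpha>\<^sub>1 = src G ?\<beta>"
    using c by (auto simp: cmp_arr src_cmp)
  have vw: "v \<otimes> w \<in> VV G V ?\<beta>" using c by (intro product_in_graded_tensor)
  have Tvw: "T (tgt G \<alpha>\<^sub>1) (v \<otimes> w) \<in> VV G V ?\<beta>" using T_VV[OF \<beta>(1) vw] \<beta>(2) by simp
  note eq = op23_tensor_VV[where X = T, OF T_clinear_on c(1) \<beta>(1) c(4) \<beta>(2) c(7)]
  show "op23 G V T a (u \<otimes> (v \<otimes> w)) \<in> cvec.span (triple_products G V a)"
    using tensor_VV_in_span[OF c(1) \<beta>(1) c(4) \<beta>(2) c(7) Tvw] by (simp add: eq[OF _ vw])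
  show "op23 G V T a (op23 G V T a (u \<otimes> (v \<otimes> w))) = \<kappa> (tgt G \<alpha>\<^sub>1) *\<^sub>C op23 G V T a (u \<otimes> (v \<otimes> w))"
    using T_square[OF \<beta>(1) vw, folded \<beta>(2)]
    by (simp add: eq[OF _ vw] eq[OF _ Tvw] tensor_scaleC_right)
qed

lemma op12_T_span:
  assumes "a \<in> obj G" "\<xi> \<in> cvec.span (triple_products G V a)"
  shows "op12 G V T a \<xi> \<in> cvec.span (triple_products G V a)"
  using clinear_op12_T[OF assms(1)] assms(2)
  by (rule clinear_image_span) (auto elim!: triple_productE intro: op12_T_triple(1))

lemma op23_T_span:
  assumes "\<xi> \<in> cvec.span (triple_products G V a)"
  shows "op23 G V T a \<xi> \<in> cvec.span (triple_products G V a)"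
  using clinear_op23_T assms
  by (rule clinear_image_span) (auto elim!: triple_productE intro: op23_T_triple(1))

lemma op12_R_check:
  assumes a: "a \<in> obj G" and \<xi>: "\<xi> \<in> cvec.span (triple_products G V a)"
  shows "op12 G V (R_check T y) a \<xi> = \<xi> + y *\<^sub>C op12 G V T a \<xi>"
  using clinear_op12[where X = "R_check T y", OF R_check_clinear_on[OF a]]
    clinear_add_scaled[where c = y, OF clinear_ident clinear_op12_T[OF a]] \<xi>
proof (rule cvec_pair.linear_eq_on)
  fix b assume "b \<in> triple_products G V a"
  then obtain u v w \<alpha>\<^sub>1 \<alpha>\<^sub>2 \<alpha>\<^sub>3
    where b: "b = u \<otimes> (v \<otimes> w)" and "composable_triple G V a \<alpha>\<^sub>1 \<alpha>\<^sub>2 \<alpha>\<^sub>3 u v w"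
    by (rule triple_productE)
  then have op12_b: "op12 G V X a b = tensor_assoc (X a (u \<otimes> v) \<otimes> w)"
    if "clinear_on (source_sum G (VV G V) a) (X a)" for X
    using op12_tensor[where X = X, OF that] by (auto simp: composable_triple_def)
  show "op12 G V (R_check T y) a b = b + y *\<^sub>C op12 G V T a b"
    unfolding op12_b[of T, OF T_clinear_on[OF a]] op12_b[of "R_check T y", OF R_check_clinear_on[OF a]]
    by (simp add: b R_check_def tensor_add_left tensor_scaleC_left tensor_assoc_tensor
        cvec_pair.linear_add[OF clinear_tensor_assoc]
        cvec_pair.linear_scale[OF clinear_tensor_assoc])
qed

lemma op23_R_check:
  assumes \<xi>: "\<xi> \<in> cvec.span (triple_products G V a)"
  shows "op23 G V (R_check T y) a \<xi> = \<xi> + y *\<^sub>C op23 G V T a \<xi>"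
  using clinear_op23[where X = "R_check T y", OF R_check_clinear_on]
    clinear_add_scaled[where c = y, OF clinear_ident clinear_op23_T] \<xi>
proof (rule cvec_pair.linear_eq_on)
  fix b assume "b \<in> triple_products G V a"
  then show "op23 G V (R_check T y) a b = b + y *\<^sub>C op23 G V T a b"
    by (auto simp: triple_products_def composable_triple_def R_check_def tensor_add_right
        op23_tensor[where X = T, OF T_clinear_on]
        op23_tensor[where X = "R_check T y", OF R_check_clinear_on] tensor_scaleC_right)
qed auto

text \<open>The condition on the parameters is \<open>x'' = (x' - x) / (1 + k x + x x')\<close> with the denominator
  cleared, \<open>k\<close> being the loop value. In the expansion of the Yang--Baxter equation it makes
  the terms in which \<open>T\<close> occurs at one position only agree.\<close>

lemma loop_coefficient:
  fixes x x' x'' k :: complex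
  assumes "x + x'' * (1 + k * x + x * x') = x'"
  shows "x' - x - x'' - x * x' * x'' = x * x'' * k"
proof -
  have "x' - x = x'' * (1 + k * x + x * x')"
    using assms by (metis add_diff_cancel_left')
  then show ?thesis by (simp add: algebra_simps)
qed

lemma op12_T_parameter_identity:
  assumes a: "a \<in> obj G" and \<xi>: "\<xi> \<in> cvec.span (triple_products G V a)"
    and x: "x + x'' * (1 + \<kappa> a * x + x * x') = x'"
  shows "(x * x'') *\<^sub>C op12 G V T a (op12 G V T a \<xi>)
    = (x' - x - x'' - x * x' * x'') *\<^sub>C op12 G V T a \<xi>"
proof -
  note lin = clinear_op12_T[OF a]
  note lin2 = clinear_compose[OF lin lin]
  have k: "x' - x - x'' - x * x' * x'' = x * x'' * \<kappa> a"
    by (rule loop_coefficient[OF x])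
  show ?thesis
    using cvec_pair.linear_compose_scale_right[OF lin2]
      cvec_pair.linear_compose_scale_right[OF lin] \<xi>
    by (rule cvec_pair.linear_eq_on)
      (auto elim!: triple_productE simp: op12_T_triple(2) k scaleC_scaleC)
qed

lemma op23_T_parameter_identity:
  assumes \<xi>: "\<xi> \<in> cvec.span (triple_products G V a)"
    and x: "\<And>\<alpha>. \<alpha> \<in> arr G \<Longrightarrow> src G \<alpha> = a \<Longrightarrow> x + x'' * (1 + \<kappa> (tgt G \<alpha>) * x + x * x') = x'"
  shows "(x * x'') *\<^sub>C op23 G V T a (op23 G V T a \<xi>)
    = (x' - x - x'' - x * x' * x'') *\<^sub>C op23 G V T a \<xi>"
  using cvec_pair.linear_compose_scale_right[OF
      clinear_compose[OF clinear_op23_T clinear_op23_T]]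
    cvec_pair.linear_compose_scale_right[OF clinear_op23_T] \<xi>
proof (rule cvec_pair.linear_eq_on)
  fix b assume "b \<in> triple_products G V a"
  then obtain u v w \<alpha>\<^sub>1 \<alpha>\<^sub>2 \<alpha>\<^sub>3
    where b: "b = u \<otimes> (v \<otimes> w)" and c: "composable_triple G V a \<alpha>\<^sub>1 \<alpha>\<^sub>2 \<alpha>\<^sub>3 u v w"
    by (rule triple_productE)
  have "x + x'' * (1 + \<kappa> (tgt G \<alpha>\<^sub>1) * x + x * x') = x'"
    using c by (intro x) (simp_all add: composable_triple_def)
  then have "x' - x - x'' - x * x' * x'' = x * x'' * \<kappa> (tgt G \<alpha>\<^sub>1)"
    by (rule loop_coefficient)
  then show "(x * x'') *\<^sub>C op23 G V T a (op23 G V T a b)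
      = (x' - x - x'' - x * x' * x'') *\<^sub>C op23 G V T a b"
    by (simp add: b op23_T_triple(2)[OF c] scaleC_scaleC)
qed

end

section \<open>Baxterization\<close>

text \<open>The expansion of both sides for two linear maps satisfying the Temperley--Lieb relations at a
  vector. The relations are required at \<open>\<xi>\<close> only, because the maps satisfy them on a subspace; the
  hypotheses on the squares are arranged so that no loop value appears, because the square of
  \<open>T\<^sup>(\<^sup>2\<^sup>3\<^sup>)(a h\<^sup>(\<^sup>1\<^sup>))\<close> is in general not a scalar multiple of the operator.\<close>

lemma Temperley_Lieb_Yang_Baxter:
  fixes A B :: "'a::complex_vector \<Rightarrow> 'a"
  assumes A: "clinear A" and B: "clinear B"
    and ABA: "A (B (A \<xi>)) = A \<xi>" and BAB: "B (A (B \<xi>)) = B \<xi>"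
    and AA: "(x * x'') *\<^sub>C A (A \<xi>) = (x' - x - x'' - x * x' * x'') *\<^sub>C A \<xi>"
    and BB: "(x * x'') *\<^sub>C B (B \<xi>) = (x' - x - x'' - x * x' * x'') *\<^sub>C B \<xi>"
  defines "RA \<equiv> \<lambda>y p. p + y *\<^sub>C A p" and "RB \<equiv> \<lambda>y p. p + y *\<^sub>C B p"
  shows "RB x (RA x' (RB x'' \<xi>)) = RA x'' (RB x' (RA x \<xi>))"
proof -
  note lin = cvec_pair.linear_add[OF A] cvec_pair.linear_add[OF B]
    cvec_pair.linear_scale[OF A] cvec_pair.linear_scale[OF B]
  define common where "common =
    \<xi> + (x * x') *\<^sub>C B (A \<xi>) + (x' * x'') *\<^sub>C A (B \<xi>) + x' *\<^sub>C A \<xi> + x' *\<^sub>C B \<xi>"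
  have "RB x (RA x' (RB x'' \<xi>)) = \<xi> + (x * x') *\<^sub>C B (A \<xi>) + (x' * x'') *\<^sub>C A (B \<xi>) + x' *\<^sub>C A \<xi>
      + ((x + x'' + x * x' * x'') *\<^sub>C B \<xi> + (x * x'') *\<^sub>C B (B \<xi>))"
    by (simp add: RA_def RB_def lin BAB scaleC_add_left scaleC_add_right scaleC_scaleC ac_simps)
  also have "\<dots> = common"
    unfolding BB common_def scaleC_add_left[symmetric] by simp
  also have "\<dots> = \<xi> + (x * x') *\<^sub>C B (A \<xi>) + (x' * x'') *\<^sub>C A (B \<xi>) + x' *\<^sub>C B \<xi>
      + ((x + x'' + x * x' * x'') *\<^sub>C A \<xi> + (x * x'') *\<^sub>C A (A \<xi>))"
    unfolding AA common_def scaleC_add_left[symmetric] by simp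
  also have "\<dots> = RA x'' (RB x' (RA x \<xi>))"
    by (simp add: RA_def RB_def lin ABA scaleC_add_left scaleC_add_right scaleC_scaleC ac_simps)
  finally show ?thesis .
qed

theorem theorem1p2:
  fixes G :: "('o, 'g) category_data"
    and V :: "'g \<Rightarrow> 'v::complex_vector set"
    and \<kappa> :: "'o \<Rightarrow> complex"
    and T :: "'o \<Rightarrow> ('g, 'v) total2 \<Rightarrow> ('g, 'v) total2"
    and f :: "'z::ab_group_add \<Rightarrow> complex"
    and z z' z'' :: 'z
    and x x' x'' :: complex
  assumes "groupoid G"
    and "graded_space_finite_type G V"
    and "\<forall>a\<in>obj G. \<kappa> a \<noteq> 0"
    and "local_dynamical_TL G V \<kappa> T"
    and "z'' = z' - z"
    and "x = f z" and "x' = f z'" and "x'' = f z''"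
    and "\<forall>a\<in>obj G. \<forall>\<alpha>\<in>arr G. src G \<alpha> = a \<longrightarrow>
      1 + \<kappa> (tgt G \<alpha>) * x + x * x' \<noteq> 0 \<and> x'' = (x' - x) / (1 + \<kappa> (tgt G \<alpha>) * x + x * x') \<and>
      1 + \<kappa> a * x + x * x' \<noteq> 0 \<and> x'' = (x' - x) / (1 + \<kappa> a * x + x * x')"
  shows "\<forall>a\<in>obj G. \<forall>\<xi>\<in>source_sum G (VVV G V) a.
    op23 G V (R_check T x) a (op12 G V (R_check T x') a (op23 G V (R_check T x'') a \<xi>)) =
    op12 G V (R_check T x'') a (op23 G V (R_check T x') a (op12 G V (R_check T x) a \<xi>))"
proof (intro ballI)
  fix a \<xi> assume a: "a \<in> obj G" and \<xi>: "\<xi> \<in> source_sum G (VVV G V) a"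
  interpret dynamical_TL G V \<kappa> T
    by (intro dynamical_TL.intro dynamical_TL_axioms.intro assms(1,4))
  let ?S = "cvec.span (triple_products G V a)"
  let ?A = "op12 G V T a" and ?B = "op23 G V T a"
  have S: "\<xi> \<in> ?S" using \<xi> source_sum_VVV_subset_span by blast
  have x_tgt: "x + x'' * (1 + \<kappa> (tgt G \<alpha>) * x + x * x') = x'" if "\<alpha> \<in> arr G" "src G \<alpha> = a" for \<alpha>
    using assms(9) a that by (auto simp: field_simps)
  \<comment> \<open>The identity arrow has target \<open>a\<close>, so the condition at \<open>a\<close> is an instance.\<close>
  have x_src: "x + x'' * (1 + \<kappa> a * x + x * x') = x'"
    using x_tgt[of "idt G a"] a by (simp add: idt_arr src_idt tgt_idt)
  have "?A (?B (?A \<xi>)) = ?A \<xi>" "?B (?A (?B \<xi>)) = ?B \<xi>"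
    using TL a \<xi> by (auto simp: local_dynamical_TL_def)
  note YB = Temperley_Lieb_Yang_Baxter[OF clinear_op12_T[OF a] clinear_op23_T this
      op12_T_parameter_identity[OF a S x_src] op23_T_parameter_identity[OF S x_tgt]]
  have step: "p + y *\<^sub>C ?A p \<in> ?S" "p + y *\<^sub>C ?B p \<in> ?S" if "p \<in> ?S" for p y
    using that op12_T_span[OF a that] op23_T_span[OF that]
    by (simp_all add: cvec.span_add cvec.span_scale)
  show "op23 G V (R_check T x) a (op12 G V (R_check T x') a (op23 G V (R_check T x'') a \<xi>)) =
    op12 G V (R_check T x'') a (op23 G V (R_check T x') a (op12 G V (R_check T x) a \<xi>))"
    using YB by (simp add: op12_R_check[OF a] op23_R_check S step)
qed

end
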